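(* For every integer $k\ge 0$, $|I_k(123,132,231)|=1$.
   Context: A permutation of length $n$ is a word $\pi=\pi_1\cdots\pi_n$ containing each of $1,\dots,n$ exactly once. The sum of permutations $\rho=\rho_1\cdots\rho_n$ and $\tau=\tau_1\cdots\tau_m$ is the permutation $\rho\oplus\tau=\rho_1\cdots\rho_n(n+\tau_1)\cdots(n+\tau_m)$ of length $n+m$. A permutation is decomposable if it equals $\rho\oplus\tau$ for some non-empty permutations $\rho,\tau$; a non-empty permutation that is not decomposable is indecomposable. An inversion of $\pi$ is a pair $(i,j)$ with $i<j$ and $\pi_i>\pi_j$. A permutation $\pi$ contains a permutation (pattern) $\tau=\tau_1\cdots\tau_m$ if there are indices $i_1<\dots<i_m$ such that $\pi_{i_1},\dots,\pi_{i_m}$ is order-isomorphic to $\tau_1,\dots,\tau_m$; otherwise $\pi$ avoids $\tau$. $I_k(\tau_1,\dots,\tau_r)$ denotes the (finite) set of all indecomposable permutations, of any length, with exactly $k$ inversions that avoid all of $\tau_1,\dots,\tau_r$. *)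

theory Defs
  imports "HOL-Combinatorics.Multiset_Permutations"
begin

(* Permutations are one-line words over {1..n}; the letter written pi_i is "\<pi> ! (i - 1)",
   since list positions count from 0. The empty word is the permutation of length 0. *)

definition is_permutation :: "nat list \<Rightarrow> bool" where
  "is_permutation \<pi> \<longleftrightarrow> \<pi> \<in> permutations_of_set {1..length \<pi>}"

definition perm_sum :: "nat list \<Rightarrow> nat list \<Rightarrow> nat list" where
  "perm_sum \<rho> \<tau> = \<rho> @ map (\<lambda>t. length \<rho> + t) \<tau>"

definition decomposable :: "nat list \<Rightarrow> bool" where
  "decomposable \<pi> \<longleftrightarrow>
    (\<exists>\<rho> \<tau>. is_permutation \<rho> \<and> is_permutation \<tau> \<and> \<rho> \<noteq> [] \<and> \<tau> \<noteq> [] \<and> \<pi> = perm_sum \<rho> \<tau>)"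

definition indecomposable :: "nat list \<Rightarrow> bool" where
  "indecomposable \<pi> \<longleftrightarrow> is_permutation \<pi> \<and> \<pi> \<noteq> [] \<and> \<not> decomposable \<pi>"

definition inversions :: "nat list \<Rightarrow> (nat \<times> nat) set" where
  "inversions \<pi> = {(i, j). i < j \<and> j < length \<pi> \<and> \<pi> ! i > \<pi> ! j}"

(* f lists the positions i_1 < ... < i_m of the occurrence. *)
definition contains_pattern :: "nat list \<Rightarrow> nat list \<Rightarrow> bool" where
  "contains_pattern \<pi> \<tau> \<longleftrightarrow>
    (\<exists>f :: nat \<Rightarrow> nat. strict_mono_on {..<length \<tau>} f \<and> f ` {..<length \<tau>} \<subseteq> {..<length \<pi>} \<and>
      (\<forall>a < length \<tau>. \<forall>b < length \<tau>. \<pi> ! f a < \<pi> ! f b \<longleftrightarrow> \<tau> ! a < \<tau> ! b))"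

definition avoids :: "nat list \<Rightarrow> nat list \<Rightarrow> bool" where
  "avoids \<pi> \<tau> \<longleftrightarrow> \<not> contains_pattern \<pi> \<tau>"

definition I :: "nat \<Rightarrow> nat list set \<Rightarrow> nat list set" where
  "I k T = {\<pi>. indecomposable \<pi> \<and> card (inversions \<pi>) = k \<and> (\<forall>\<tau>\<in>T. avoids \<pi> \<tau>)}"

end

theory Submission imports Defs begin

text \<open>
  Suppose that a permutation has letters \<open>a\<close>, \<open>b\<close> with \<open>a < b\<close> and \<open>a\<close> before \<open>b\<close>, and that \<open>b\<close>
  is not the last letter \<open>x\<close>. Then \<open>a\<close>, \<open>b\<close>, \<open>x\<close> form the pattern 123, 132 or 231, according to
  the relative size of \<open>x\<close>. As all three patterns begin with an ascent, a non-empty permutation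
  avoids them if and only if it is a decreasing word followed by one arbitrary letter
  (lemma \<open>avoids_iff_decreasing\<close>). Such a permutation is determined by the length \<open>m\<close> of the
  decreasing word and the last letter \<open>x \<in> {1..m + 1}\<close>. It has \<open>(m choose 2) + (m + 1 - x)\<close>
  inversions (lemma \<open>card_inversions_decreasing_snoc\<close>) and it is indecomposable if and only if
  \<open>m = 0\<close> or \<open>x \<le> m\<close>: it starts with its greatest letter \<open>m + 1\<close> in the latter case, and a
  word of length at least two that ends with its greatest letter is decomposable
  (lemma \<open>indecomposable_snoc_iff\<close>). Put \<open>j = m + 1 - x\<close>. The theorem then says that
  every \<open>k\<close> is \<open>(m choose 2) + j\<close> for exactly one pair with \<open>1 \<le> j \<le> m\<close> or \<open>m = j = 0\<close>. This holds
  because consecutive triangular numbers satisfy \<open>(m + 1 choose 2) = (m choose 2) + m\<close>.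
\<close>

section \<open>Avoidance of 123, 132 and 231\<close>

lemma is_permutation_iff: "is_permutation \<pi> \<longleftrightarrow> distinct \<pi> \<and> set \<pi> = {1..length \<pi>}"
  by (auto simp: is_permutation_def permutations_of_set_def)

lemma contains_pattern_3_iff:
  "contains_pattern \<pi> [a, b, c] \<longleftrightarrow>
    (\<exists>p q r. p < q \<and> q < r \<and> r < length \<pi> \<and>
      (\<pi> ! p < \<pi> ! q \<longleftrightarrow> a < b) \<and> (\<pi> ! q < \<pi> ! p \<longleftrightarrow> b < a) \<and>
      (\<pi> ! p < \<pi> ! r \<longleftrightarrow> a < c) \<and> (\<pi> ! r < \<pi> ! p \<longleftrightarrow> c < a) \<and>
      (\<pi> ! q < \<pi> ! r \<longleftrightarrow> b < c) \<and> (\<pi> ! r < \<pi> ! q \<longleftrightarrow> c < b))"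
  (is "?L \<longleftrightarrow> ?R")
proof -
  have all3: "(\<forall>n<3. P n) \<longleftrightarrow> P 0 \<and> P 1 \<and> P 2" for P :: "nat \<Rightarrow> bool"
    by (auto simp: numeral_3_eq_3 numeral_2_eq_2 less_Suc_eq)
  have set3: "{..<3} = {0, 1, 2::nat}"
    by auto
  show ?thesis
  proof
    assume ?L
    then obtain f where f: "strict_mono_on {..<3} f" "f ` {..<3} \<subseteq> {..<length \<pi>}"
      "\<forall>p<3. \<forall>q<3. \<pi> ! f p < \<pi> ! f q \<longleftrightarrow> [a, b, c] ! p < [a, b, c] ! q"
      by (auto simp: contains_pattern_def numeral_3_eq_3)
    have "f 0 < f 1" "f 1 < f 2" "f 2 < length \<pi>"
      using f(1,2) by (auto simp: strict_mono_on_def set3)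
    with f(3) show ?R
      unfolding all3 by (intro exI[of _ "f 0"] exI[of _ "f 1"] exI[of _ "f 2"]) simp
  next
    assume ?R
    then obtain p q r where "p < q" "q < r" "r < length \<pi>"
      "\<pi> ! p < \<pi> ! q \<longleftrightarrow> a < b" "\<pi> ! q < \<pi> ! p \<longleftrightarrow> b < a"
      "\<pi> ! p < \<pi> ! r \<longleftrightarrow> a < c" "\<pi> ! r < \<pi> ! p \<longleftrightarrow> c < a"
      "\<pi> ! q < \<pi> ! r \<longleftrightarrow> b < c" "\<pi> ! r < \<pi> ! q \<longleftrightarrow> c < b"
      by blast
    then have "strict_mono_on {..<3} ((!) [p, q, r])" "(!) [p, q, r] ` {..<3} \<subseteq> {..<length \<pi>}"
      "\<forall>s<3. \<forall>t<3. \<pi> ! ([p, q, r] ! s) < \<pi> ! ([p, q, r] ! t) \<longleftrightarrow> [a, b, c] ! s < [a, b, c] ! t"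
      unfolding all3 by (auto simp: strict_mono_on_def set3)
    then show ?L
      unfolding contains_pattern_def
      by (intro exI[of _ "(!) [p, q, r]"]) (simp add: numeral_3_eq_3)
  qed
qed

lemma avoids_iff_decreasing:
  assumes "distinct (xs @ [x])"
  shows "(\<forall>\<tau>\<in>{[1, 2, 3], [1, 3, 2], [2, 3, 1]}. avoids (xs @ [x]) \<tau>) \<longleftrightarrow> sorted_wrt (>) xs"
    (is "?L \<longleftrightarrow> ?R")
proof
  assume avoid: ?L
  show ?R
    unfolding sorted_wrt_iff_nth_less
    \<comment> \<open>An ascent inside \<open>xs\<close> extends by the last letter to one of the three patterns.\<close>
  proof (intro allI impI, rule ccontr)
    fix p q assume pq: "p < q" "q < length xs" "\<not> xs ! p > xs ! q"
    then have "xs ! p \<in> set xs" "xs ! q \<in> set xs" "xs ! p \<noteq> xs ! q"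
      using assms by (auto simp: nth_eq_iff_index_eq)
    then have asc: "xs ! p < xs ! q" "xs ! p \<noteq> x" "xs ! q \<noteq> x"
      using assms pq(3) by auto
    let ?occ = "\<lambda>\<tau>. contains_pattern (xs @ [x]) \<tau>"
    consider "xs ! q < x" | "xs ! p < x" "x < xs ! q" | "x < xs ! p"
      using asc by linarith
    then have "?occ [1, 2, 3] \<or> ?occ [1, 3, 2] \<or> ?occ [2, 3, 1]"
    proof cases
      case 1
      then have "?occ [1, 2, 3]"
        unfolding contains_pattern_3_iff using pq asc
        by (intro exI[of _ p] exI[of _ q] exI[of _ "length xs"]) (auto simp: nth_append)
      then show ?thesis by blast
    next
      case 2
      then have "?occ [1, 3, 2]"
        unfolding contains_pattern_3_iff using pq asc
        by (intro exI[of _ p] exI[of _ q] exI[of _ "length xs"]) (auto simp: nth_append)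
      then show ?thesis by blast
    next
      case 3
      then have "?occ [2, 3, 1]"
        unfolding contains_pattern_3_iff using pq asc
        by (intro exI[of _ p] exI[of _ q] exI[of _ "length xs"]) (auto simp: nth_append)
      then show ?thesis by blast
    qed
    with avoid show False
      by (simp add: avoids_def)
  qed
next
  assume dec: ?R
  have "avoids (xs @ [x]) [a, b, c]" if "a < b" for a b c
  proof -
    have "\<not> (xs @ [x]) ! p < (xs @ [x]) ! q" if "p < q" "q < r" "r < length (xs @ [x])" for p q r
      using dec that by (force simp: sorted_wrt_iff_nth_less nth_append)
    then show ?thesis
      using \<open>a < b\<close> unfolding avoids_def contains_pattern_3_iff by blast
  qed
  then show ?L
    by simp
qed

section \<open>Inversions and indecomposability of a decreasing word with one letter appended\<close>

lemma card_pairs_less: "card {(i, j). i < j \<and> j < m} = m choose 2" for m :: nat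
proof -
  have "{(i, j). i < j \<and> j < m} = prod.swap ` (SIGMA j:{..<m}. {..<j})"
    by (auto simp: image_iff)
  then have "card {(i, j). i < j \<and> j < m} = card (SIGMA j:{..<m}. {..<j})"
    by (simp add: card_image)
  also have "\<dots> = (\<Sum>j<m. j)"
    by simp
  also have "\<dots> = m choose 2"
    by (induction m) (auto simp: numeral_2_eq_2)
  finally show ?thesis .
qed

lemma card_inversions_decreasing_snoc:
  assumes perm: "is_permutation (xs @ [x])" and dec: "sorted_wrt (>) xs"
  shows "card (inversions (xs @ [x])) = (length xs choose 2) + (Suc (length xs) - x)"
proof -
  let ?m = "length xs"
  let ?A = "{(i, j). i < j \<and> j < ?m}"
  \<comment> \<open>The inversions inside \<open>xs\<close> are all pairs of positions; the others involve the last letter.\<close>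
  let ?B = "{i. i < ?m \<and> xs ! i > x}"
  have "inversions (xs @ [x]) = ?A \<union> (\<lambda>i. (i, ?m)) ` ?B"
    using dec by (auto simp: inversions_def sorted_wrt_iff_nth_less nth_append less_Suc_eq)
  moreover have "card ((\<lambda>i. (i, ?m)) ` ?B) = card ?B"
    by (simp add: card_image inj_on_def)
  moreover have "finite ?A"
    by (rule finite_subset[of _ "{..<?m} \<times> {..<?m}"]) auto
  moreover have "?A \<inter> (\<lambda>i. (i, ?m)) ` ?B = {}"
    by auto
  ultimately have card: "card (inversions (xs @ [x])) = (?m choose 2) + card ?B"
    by (simp add: card_Un_disjoint card_pairs_less)
  have "inj_on ((!) xs) ?B"
    using perm by (auto simp: is_permutation_iff inj_on_def nth_eq_iff_index_eq)
  then have "card ?B = card ((!) xs ` ?B)"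
    by (simp add: card_image)
  also have "(!) xs ` ?B = {y \<in> set (xs @ [x]). y > x}"
    by (auto simp: in_set_conv_nth)
  also have "\<dots> = {x<..Suc ?m}"
    using perm unfolding is_permutation_iff by auto
  finally show ?thesis
    using card by simp
qed

lemma indecomposable_snoc_iff:
  assumes perm: "is_permutation (xs @ [x])" and dec: "sorted_wrt (>) xs"
  shows "indecomposable (xs @ [x]) \<longleftrightarrow> xs = [] \<or> x \<le> length xs"
proof -
  let ?m = "length xs"
  have set: "insert x (set xs) = {1..Suc ?m}" and dist: "distinct xs" "x \<notin> set xs"
    using perm by (auto simp: is_permutation_iff)
  have "decomposable (xs @ [x])" if "xs \<noteq> []" "\<not> x \<le> ?m"
  proof -
    have x: "x = Suc ?m"
      using set that by (metis insertI1 atLeastAtMost_iff not_less_eq_eq le_antisym)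
    have "set xs = insert x (set xs) - {x}"
      using dist(2) by simp
    also have "\<dots> = {1..?m}"
      unfolding set using x by auto
    finally have "is_permutation xs" "is_permutation [1]"
      using dist by (auto simp: is_permutation_iff)
    moreover have "xs @ [x] = perm_sum xs [1]"
      by (simp add: perm_sum_def x)
    ultimately show ?thesis
      unfolding decomposable_def using that(1) by blast
  qed
  moreover have "xs \<noteq> [] \<and> \<not> x \<le> ?m" if "decomposable (xs @ [x])"
  proof -
    from that obtain \<rho> \<tau> where \<rho>\<tau>: "is_permutation \<rho>" "\<rho> \<noteq> []" "\<tau> \<noteq> []"
      and eq: "xs @ [x] = perm_sum \<rho> \<tau>"
      unfolding decomposable_def by blast
    have "Suc ?m = length \<rho> + length \<tau>"
      using arg_cong[OF eq, of length] by (simp add: perm_sum_def)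
    moreover have pos: "0 < length \<rho>" "0 < length \<tau>"
      using \<rho>\<tau>(2,3) by simp_all
    ultimately have len: "length \<rho> \<le> ?m"
      by linarith
    with pos(1) have ne: "xs \<noteq> []"
      by (metis leD list.size(3))
    \<comment> \<open>The first letter lies in the proper prefix \<open>\<rho>\<close>, so it is not the greatest letter. As it is
      the maximum of \<open>xs\<close>, the greatest letter must be the last one.\<close>
    have hd: "hd xs = hd \<rho>"
      using arg_cong[OF eq, of hd] ne \<rho>\<tau>(2) by (simp add: perm_sum_def)
    have "hd \<rho> \<le> length \<rho>"
      using \<rho>\<tau>(1,2) hd_in_set[of \<rho>] by (auto simp: is_permutation_iff)
    then have "hd xs \<le> ?m"
      using hd len by simp
    moreover have "y \<le> hd xs" if "y \<in> set xs" for y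
      using dec that by (cases xs) auto
    ultimately have "Suc ?m \<notin> set xs"
      by force
    moreover have "Suc ?m \<in> insert x (set xs)"
      unfolding set by simp
    ultimately show ?thesis
      using ne by auto
  qed
  ultimately show ?thesis
    using perm by (auto simp: indecomposable_def)
qed

section \<open>Parametrisation by length and last letter\<close>

lemma decreasing_permutation_determined_by_last:
  assumes "is_permutation (xs @ [x])" "sorted_wrt (>) xs"
    and "is_permutation (ys @ [x])" "sorted_wrt (>) ys" "length xs = length ys"
  shows "xs = ys"
proof -
  have "set xs = {1..Suc (length xs)} - {x}" "set ys = {1..Suc (length ys)} - {x}"
    using assms by (auto simp: is_permutation_iff)
  then have "set (rev xs) = set (rev ys)"
    using assms(5) by simp
  then have "rev xs = rev ys"
    using assms(2,4)
    by (intro strict_sorted_equal) (auto simp: sorted_wrt_rev)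
  then show ?thesis
    by simp
qed

lemma ex_decreasing_permutation:
  assumes "x \<in> {1..Suc m}"
  shows "\<exists>xs. length xs = m \<and> is_permutation (xs @ [x]) \<and> sorted_wrt (>) xs"
proof -
  let ?xs = "rev (sorted_list_of_set ({1..Suc m} - {x}))"
  have len: "length ?xs = m"
    using assms by simp
  have "set (?xs @ [x]) = {1..length (?xs @ [x])}"
    using assms len by (auto simp del: length_rev length_sorted_list_of_set)
  moreover have "sorted_wrt (>) ?xs"
    by (simp add: sorted_wrt_rev)
  ultimately show ?thesis
    using len unfolding is_permutation_iff by (intro exI[of _ ?xs]) auto
qed

section \<open>Decomposition of an integer by triangular numbers\<close>

lemma ex_triangular_decomposition:
  "\<exists>m j. k = (m choose 2) + j \<and> j \<le> m \<and> (m = 0 \<or> 0 < j)" for k :: nat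
proof (induction k)
  case 0
  show ?case
    by (intro exI[of _ 0]) simp
next
  case (Suc k)
  then obtain m j where mj: "k = (m choose 2) + j" "j \<le> m"
    by blast
  show ?case
  proof (cases "j < m")
    case True
    with mj show ?thesis
      by (intro exI[of _ m] exI[of _ "Suc j"]) simp
  next
    case False
    \<comment> \<open>Now \<open>j = m\<close>, so \<open>k\<close> is the triangular number \<open>Suc m choose 2\<close>.\<close>
    with mj show ?thesis
      by (intro exI[of _ "Suc m"] exI[of _ 1]) (simp add: numeral_2_eq_2)
  qed
qed

lemma triangular_decomposition_unique:
  fixes m j m' j' :: nat
  assumes "(m choose 2) + j = (m' choose 2) + j'"
    and "j \<le> m" "m = 0 \<or> 0 < j" "j' \<le> m'" "m' = 0 \<or> 0 < j'"
  shows "m = m' \<and> j = j'"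
proof -
  \<comment> \<open>The values with parameter \<open>a\<close> lie above \<open>a choose 2\<close>, except for \<open>a = 0\<close>, and at most at
    \<open>Suc a choose 2\<close>, so different parameters give disjoint ranges.\<close>
  have less: "(a choose 2) + i < (b choose 2) + l"
    if "a < b" "i \<le> a" "b = 0 \<or> 0 < l" for a b i l :: nat
  proof -
    have "(a choose 2) + i \<le> Suc a choose 2"
      using that(2) by (simp add: numeral_2_eq_2)
    also have "\<dots> \<le> b choose 2"
      using that(1) by (intro binomial_right_mono) simp
    also have "\<dots> < (b choose 2) + l"
      using that by simp
    finally show ?thesis .
  qed
  have "m = m'"
    using less[of m m' j j'] less[of m' m j' j] assms by (cases m m' rule: linorder_cases) auto
  with assms(1) show ?thesis
    by simp
qed

section \<open>Counting\<close>

lemma mem_I_iff: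
  "\<pi> \<in> I k {[1, 2, 3], [1, 3, 2], [2, 3, 1]} \<longleftrightarrow>
    (\<exists>xs x. \<pi> = xs @ [x] \<and> is_permutation \<pi> \<and> sorted_wrt (>) xs \<and>
      (xs = [] \<or> x \<le> length xs) \<and> (length xs choose 2) + (Suc (length xs) - x) = k)"
proof (cases \<pi> rule: rev_exhaust)
  case Nil
  then show ?thesis
    by (simp add: I_def indecomposable_def)
next
  case (snoc xs x)
  show ?thesis
  proof (cases "is_permutation \<pi>")
    case True
    then have "distinct (xs @ [x])"
      by (simp add: snoc is_permutation_iff)
    then have "\<pi> \<in> I k {[1, 2, 3], [1, 3, 2], [2, 3, 1]} \<longleftrightarrow>
        indecomposable (xs @ [x]) \<and> card (inversions (xs @ [x])) = k \<and> sorted_wrt (>) xs"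
      unfolding I_def mem_Collect_eq snoc by (simp only: avoids_iff_decreasing)
    also have "\<dots> \<longleftrightarrow> sorted_wrt (>) xs \<and> (xs = [] \<or> x \<le> length xs) \<and>
        (length xs choose 2) + (Suc (length xs) - x) = k"
      using True card_inversions_decreasing_snoc[of xs x] indecomposable_snoc_iff[of xs x]
      by (cases "sorted_wrt (>) xs") (simp_all add: snoc)
    finally show ?thesis
      using True unfolding snoc by simp
  next
    case False
    then show ?thesis
      by (auto simp: I_def indecomposable_def)
  qed
qed

theorem theorem20:
  fixes k :: nat
  shows "card (I k {[1, 2, 3], [1, 3, 2], [2, 3, 1]}) = 1"
proof -
  let ?I = "I k {[1, 2, 3], [1, 3, 2], [2, 3, 1]}"
  obtain m j where mj: "k = (m choose 2) + j" "j \<le> m" "m = 0 \<or> 0 < j"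
    using ex_triangular_decomposition by blast
  have "Suc m - j \<in> {1..Suc m}"
    using mj(2) by auto
  from ex_decreasing_permutation[OF this]
  obtain xs where xs: "length xs = m" "is_permutation (xs @ [Suc m - j])" "sorted_wrt (>) xs"
    by blast
  have "xs @ [Suc m - j] \<in> ?I"
    unfolding mem_I_iff using xs mj by auto
  moreover have "\<pi> = xs @ [Suc m - j]" if "\<pi> \<in> ?I" for \<pi>
  proof -
    from that obtain ys y where ys: "\<pi> = ys @ [y]" "is_permutation (ys @ [y])" "sorted_wrt (>) ys"
      "ys = [] \<or> y \<le> length ys" "(length ys choose 2) + (Suc (length ys) - y) = k"
      unfolding mem_I_iff by blast
    have "y \<in> set (ys @ [y])"
      by simp
    then have y: "1 \<le> y" "y \<le> Suc (length ys)"
      using ys(2) unfolding is_permutation_iff by auto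
    have "length ys = m \<and> Suc (length ys) - y = j"
      using ys(4,5) y mj by (intro triangular_decomposition_unique) auto
    then have "length ys = length xs" "y = Suc m - j"
      using y xs(1) by auto
    then show ?thesis
      using decreasing_permutation_determined_by_last[of ys y xs] ys xs by simp
  qed
  ultimately have "?I = {xs @ [Suc m - j]}"
    by blast
  then show ?thesis
    by simp
qed

end
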